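(* Let $G=(V,E)$ be a graph with $\deg(u)\le 3$ for all $u\in V$. Let $G_C$ be the combinatorial graph and $G_N$ the normalized graph obtained by equipping $G$ with the combinatorial weights and the normalized weights respectively. Then $\kappa(G_C)\ge 0$ if and only if $\kappa(G_N)\ge 0$.
   Context: All graphs are undirected, connected, locally finite and simple, with combinatorial distance $d$; $\deg(u)$ is the number of neighbors of $u$. A weighted graph carries a symmetric edge weight $w:E\to(0,\infty)$ and a vertex weight $m:V\to(0,\infty)$. Combinatorial weights: $w\equiv1$, $m\equiv 1$. Normalized weights: $w\equiv1$, $m(u)=\deg(u)$. Let $\mathrm{Deg}(u)=\sum_{v\sim u}w(u,v)/m(u)$. For small $\varepsilon>0$ let $\mu_u^\varepsilon$ be the probability measure with $\mu_u^\varepsilon(u)=1-\varepsilon\,\mathrm{Deg}(u)$, $\mu_u^\varepsilon(v)=\varepsilon w(u,v)/m(u)$ if $v\sim u$, and $0$ otherwise. The Wasserstein distance is $W(\mu,\nu)=\inf_A\sum_{u,v\in V}A(u,v)d(u,v)$, the infimum over all couplings $A:V\times V\to[0,1]$ with $\sum_v A(u,v)=\mu(u)$ and $\sum_u A(u,v)=\nu(v)$. Put $\kappa_\varepsilon(u,v)=1-W(\mu_u^\varepsilon,\mu_v^\varepsilon)/d(u,v)$; the Lin-Lu-Yau-Ollivier Ricci curvature is $\kappa(u,v)=\lim_{\varepsilon\to0^+}\frac1\varepsilon\kappa_\varepsilon(u,v)$ (the limit exists). For a weighted graph $G$, $\kappa(G)=\inf_{uv\in E}\kappa(u,v)$. 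*)

theory Defs
  imports "HOL-Analysis.Analysis"
begin

text \<open>
  A graph has a vertex set \<open>V\<close> (a subset of an arbitrary type, possibly infinite) and an edge
  relation \<open>E\<close>, in which an undirected edge \<open>uv\<close> appears as both \<open>(u, v)\<close> and \<open>(v, u)\<close>.
\<close>

locale simple_graph =
  fixes V :: "'a set" and E :: "('a \<times> 'a) set"
  assumes edges: "E \<subseteq> V \<times> V"
    and symmetric: "sym E"
    and loopless: "irrefl E"
    and locally_finite: "u \<in> V \<Longrightarrow> finite (E `` {u})"
    and connected: "u \<in> V \<Longrightarrow> v \<in> V \<Longrightarrow> (u, v) \<in> E\<^sup>*"

locale weighted_graph = simple_graph V E
  for V :: "'a set" and E :: "('a \<times> 'a) set" +
  fixes w :: "'a \<Rightarrow> 'a \<Rightarrow> real" and m :: "'a \<Rightarrow> real"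
  assumes w_symmetric: "(u, v) \<in> E \<Longrightarrow> w u v = w v u"
    and w_positive: "(u, v) \<in> E \<Longrightarrow> w u v > 0"
    and m_positive: "u \<in> V \<Longrightarrow> m u > 0"

definition vertex_degree :: "('a \<times> 'a) set \<Rightarrow> 'a \<Rightarrow> nat" where
  "vertex_degree E u = card (E `` {u})"

text \<open>The pair \<open>(u, v)\<close> is in \<open>E ^^ n\<close> iff there is a walk of length \<open>n\<close> from \<open>u\<close> to \<open>v\<close>.\<close>

definition graph_dist :: "('a \<times> 'a) set \<Rightarrow> 'a \<Rightarrow> 'a \<Rightarrow> nat" where
  "graph_dist E u v = (LEAST n. (u, v) \<in> E ^^ n)"

definition weighted_degree ::
  "('a \<times> 'a) set \<Rightarrow> ('a \<Rightarrow> 'a \<Rightarrow> real) \<Rightarrow> ('a \<Rightarrow> real) \<Rightarrow> 'a \<Rightarrow> real" where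
  "weighted_degree E w m u = (\<Sum>v\<in>E `` {u}. w u v / m u)"

definition step_measure ::
  "('a \<times> 'a) set \<Rightarrow> ('a \<Rightarrow> 'a \<Rightarrow> real) \<Rightarrow> ('a \<Rightarrow> real) \<Rightarrow> real \<Rightarrow> 'a \<Rightarrow> 'a \<Rightarrow> real" where
  "step_measure E w m \<epsilon> u v =
     (if v = u then 1 - \<epsilon> * weighted_degree E w m u
      else if (u, v) \<in> E then \<epsilon> * w u v / m u
      else 0)"

definition couplings :: "'a set \<Rightarrow> ('a \<Rightarrow> real) \<Rightarrow> ('a \<Rightarrow> real) \<Rightarrow> ('a \<Rightarrow> 'a \<Rightarrow> real) set" where
  "couplings V \<mu> \<nu> =
     {A. (\<forall>u\<in>V. \<forall>v\<in>V. A u v \<in> {0..1}) \<and>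
         (\<forall>u\<in>V. ((\<lambda>v. A u v) has_sum \<mu> u) V) \<and>
         (\<forall>v\<in>V. ((\<lambda>u. A u v) has_sum \<nu> v) V)}"

text \<open>
  The cost is stated with \<open>has_sum\<close> rather than \<open>infsum\<close>, so that a coupling of infinite cost is
  ignored instead of being assigned cost \<open>0\<close>.
\<close>

definition wasserstein ::
  "'a set \<Rightarrow> ('a \<times> 'a) set \<Rightarrow> ('a \<Rightarrow> real) \<Rightarrow> ('a \<Rightarrow> real) \<Rightarrow> real" where
  "wasserstein V E \<mu> \<nu> =
     Inf {c. \<exists>A\<in>couplings V \<mu> \<nu>.
            ((\<lambda>(u, v). A u v * real (graph_dist E u v)) has_sum c) (V \<times> V)}"

definition eps_curvature ::
  "'a set \<Rightarrow> ('a \<times> 'a) set \<Rightarrow> ('a \<Rightarrow> 'a \<Rightarrow> real) \<Rightarrow> ('a \<Rightarrow> real) \<Rightarrow> real \<Rightarrow> 'a \<Rightarrow> 'a \<Rightarrow> real" where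
  "eps_curvature V E w m \<epsilon> u v =
     1 - wasserstein V E (step_measure E w m \<epsilon> u) (step_measure E w m \<epsilon> v)
           / real (graph_dist E u v)"

definition curvature ::
  "'a set \<Rightarrow> ('a \<times> 'a) set \<Rightarrow> ('a \<Rightarrow> 'a \<Rightarrow> real) \<Rightarrow> ('a \<Rightarrow> real) \<Rightarrow> 'a \<Rightarrow> 'a \<Rightarrow> real" where
  "curvature V E w m u v = Lim (at_right 0) (\<lambda>\<epsilon>. 1 / \<epsilon> * eps_curvature V E w m \<epsilon> u v)"

text \<open>
  The infimum is taken in the extended reals: it may be \<open>-\<infinity>\<close> on an infinite graph, and it is
  \<open>\<infinity>\<close> on a graph without edges.
\<close>

definition graph_curvature ::
  "'a set \<Rightarrow> ('a \<times> 'a) set \<Rightarrow> ('a \<Rightarrow> 'a \<Rightarrow> real) \<Rightarrow> ('a \<Rightarrow> real) \<Rightarrow> ereal" where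
  "graph_curvature V E w m = (INF (u, v)\<in>E. ereal (curvature V E w m u v))"

definition unit_edge_weight :: "'a \<Rightarrow> 'a \<Rightarrow> real" where
  "unit_edge_weight u v = 1"

definition combinatorial_vertex_weight :: "'a \<Rightarrow> real" where
  "combinatorial_vertex_weight u = 1"

definition normalized_vertex_weight :: "('a \<times> 'a) set \<Rightarrow> 'a \<Rightarrow> real" where
  "normalized_vertex_weight E u = real (vertex_degree E u)"

lemma (in simple_graph) combinatorial_weighted_graph:
  "weighted_graph V E unit_edge_weight combinatorial_vertex_weight"
  by unfold_locales (auto simp: unit_edge_weight_def combinatorial_vertex_weight_def)

text \<open>The one-vertex graph is excluded here, as its normalized vertex weight would be \<open>0\<close>.\<close>

lemma (in simple_graph) normalized_weighted_graph:
  assumes "E \<noteq> {}"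
  shows "weighted_graph V E unit_edge_weight (normalized_vertex_weight E)"
proof unfold_locales
  fix u assume u: "u \<in> V"
  obtain a b where ab: "(a, b) \<in> E" using assms by auto
  have "\<exists>x. (u, x) \<in> E"
  proof (cases "u = a")
    case True
    then show ?thesis using ab by auto
  next
    case False
    have "(u, a) \<in> E\<^sup>*" using connected u ab edges by auto
    then show ?thesis using False by (meson converse_rtranclE)
  qed
  then show "normalized_vertex_weight E u > 0"
    using locally_finite[OF u]
    by (auto simp: normalized_vertex_weight_def vertex_degree_def card_gt_0_iff)
qed (auto simp: unit_edge_weight_def)

end

theory Submission imports Defs begin

text \<open>
  The equivalence holds edge by edge. If the endpoints of an edge have the same degree \<open>k\<close>, then
  normalizing only divides the curvature by \<open>k\<close>. Otherwise the degrees are \<open>(1, 2)\<close>, \<open>(1, 3)\<close> or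
  \<open>(2, 3)\<close>. An edge at a leaf has nonnegative curvature for both weights, by explicit transport plans
  of cost at most \<open>1\<close>. For \<open>x\<close> with neighbours \<open>y, a\<close> and \<open>y\<close> with neighbours \<open>x, b, c\<close>, explicit
  plans again give nonnegative curvature for both weights if \<open>a\<close> is at distance at most \<open>2\<close> from \<open>b\<close>
  or \<open>c\<close>. If \<open>a\<close> is at distance \<open>3\<close> from both, the 1-Lipschitz function with values
  \<open>-1, 0, 1, 2, 2\<close> at \<open>a, x, y, b, c\<close> shows that both curvatures are negative.
\<close>

section \<open>Graph distance as a metric on the vertices\<close>

context simple_graph
begin

lemma graph_dist_le: "(u, v) \<in> E ^^ n \<Longrightarrow> graph_dist E u v \<le> n"
  unfolding graph_dist_def by (rule Least_le)

text \<open>Connectivity supplies some walk, so the \<open>LEAST\<close> in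
  \<open>graph_dist\<close> is attained rather than unspecified.\<close>

lemma walk_graph_dist:
  assumes "u \<in> V" "v \<in> V"
  shows "(u, v) \<in> E ^^ graph_dist E u v"
proof -
  obtain n where "(u, v) \<in> E ^^ n"
    using rtrancl_imp_relpow[OF connected[OF assms]] by blast
  then show ?thesis unfolding graph_dist_def by (rule LeastI)
qed

lemma graph_dist_triangle:
  assumes "u \<in> V" "v \<in> V" "z \<in> V"
  shows "graph_dist E u z \<le> graph_dist E u v + graph_dist E v z"
  by (rule graph_dist_le[OF relpow_trans[OF walk_graph_dist walk_graph_dist]]) (use assms in auto)

lemma graph_dist_self [simp]: "graph_dist E u u = 0"
  using graph_dist_le[of u u 0] by simp

lemma graph_dist_pos: "u \<in> V \<Longrightarrow> v \<in> V \<Longrightarrow> u \<noteq> v \<Longrightarrow> 1 \<le> graph_dist E u v"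
  using walk_graph_dist[of u v] by (cases "graph_dist E u v") auto

lemma graph_dist_adjacent: "(u, v) \<in> E \<Longrightarrow> graph_dist E u v = 1"
  using graph_dist_le[of u v 1] graph_dist_pos[of u v] edges loopless
  by (force simp: irrefl_def)

lemma relpow_symmetric: "(u, v) \<in> E ^^ n \<Longrightarrow> (v, u) \<in> E ^^ n"
proof (induction n arbitrary: v)
  case (Suc n)
  from Suc.prems obtain y where "(u, y) \<in> E ^^ n" "(y, v) \<in> E" by auto
  then show ?case using Suc.IH symD[OF symmetric] relpow_Suc_I2 by metis
qed auto

lemma graph_dist_commute: "graph_dist E u v = graph_dist E v u"
  unfolding graph_dist_def using relpow_symmetric by (intro arg_cong[where f = Least]) blast

end

section \<open>Transport costs and symmetry of the curvature\<close>

lemma couplings_swap: "A \<in> couplings V \<mu> \<nu> \<Longrightarrow> (\<lambda>u v. A v u) \<in> couplings V \<nu> \<mu>"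
  by (auto simp: couplings_def)

text \<open>The set under the infimum in \<open>wasserstein\<close>, kept apart because a real
  \<open>Inf\<close> is informative only for a nonempty set bounded below: plans yield members,
  duality bounds all members, and nonemptiness is shown on its own.\<close>

definition transport_costs ::
  "'a set \<Rightarrow> ('a \<times> 'a) set \<Rightarrow> ('a \<Rightarrow> real) \<Rightarrow> ('a \<Rightarrow> real) \<Rightarrow> real set" where
  "transport_costs V E \<mu> \<nu> = {c. \<exists>A\<in>couplings V \<mu> \<nu>.
     ((\<lambda>(u, v). A u v * real (graph_dist E u v)) has_sum c) (V \<times> V)}"

lemma wasserstein_eq_Inf: "wasserstein V E \<mu> \<nu> = Inf (transport_costs V E \<mu> \<nu>)"
  by (simp add: wasserstein_def transport_costs_def)

lemma transport_costs_nonneg: "c \<in> transport_costs V E \<mu> \<nu> \<Longrightarrow> 0 \<le> c"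
  by (force simp: transport_costs_def couplings_def intro: has_sum_nonneg)

lemma wasserstein_le: "c \<in> transport_costs V E \<mu> \<nu> \<Longrightarrow> wasserstein V E \<mu> \<nu> \<le> c"
  unfolding wasserstein_eq_Inf
  by (intro cInf_lower bdd_belowI[of _ 0]) (auto dest: transport_costs_nonneg)

lemma (in simple_graph) transport_costs_swap:
  "transport_costs V E \<mu> \<nu> \<subseteq> transport_costs V E \<nu> \<mu>"
proof
  fix c assume "c \<in> transport_costs V E \<mu> \<nu>"
  then obtain A where A: "A \<in> couplings V \<mu> \<nu>"
    "((\<lambda>(u, v). A u v * real (graph_dist E u v)) has_sum c) (V \<times> V)"
    by (auto simp: transport_costs_def)
  from A(2) have "((\<lambda>(u, v). A v u * real (graph_dist E u v)) has_sum c) (V \<times> V)"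
    by (subst (asm) has_sum_swap) (simp add: graph_dist_commute)
  with couplings_swap[OF A(1)] show "c \<in> transport_costs V E \<nu> \<mu>"
    by (auto simp: transport_costs_def)
qed

text \<open>Lets the case analysis put the endpoint of smaller degree first.\<close>

lemma (in simple_graph) curvature_commute:
  "curvature V E w m u v = curvature V E w m v u"
proof -
  have "transport_costs V E \<mu> \<nu> = transport_costs V E \<nu> \<mu>" for \<mu> \<nu>
    using transport_costs_swap by blast
  then show ?thesis
    unfolding curvature_def eps_curvature_def wasserstein_eq_Inf
    by (metis graph_dist_commute)
qed

section \<open>Upper bounds from explicit plans, lower bounds from duality\<close>

lemma has_sum_sum_list:
  fixes f :: "'b \<Rightarrow> 'a \<Rightarrow> 'c::topological_comm_monoid_add"
  assumes "\<And>x. x \<in> set xs \<Longrightarrow> (f x has_sum g x) A"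
  shows "((\<lambda>a. \<Sum>x\<leftarrow>xs. f x a) has_sum (\<Sum>x\<leftarrow>xs. g x)) A"
  using assms by (induction xs) (auto intro: has_sum_add)

lemma has_sum_point_mass:
  fixes c :: real
  assumes "s \<in> A"
  shows "((\<lambda>u. c * of_bool (u = s)) has_sum c) A"
  by (rule has_sum_finite_neutralI[of "{s}"]) (use assms in auto)

text \<open>An entry \<open>(p, s, t)\<close> moves mass \<open>p\<close> from \<open>s\<close> to
  \<open>t\<close>. The coupling is a finite sum of point masses, so every sum over \<open>V\<close>
  reduces to one over the list. Repeated pairs add up, hence vertices of a plan may
  coincide.\<close>

lemma transport_costs_plan:
  fixes \<mu> \<nu> :: "'a \<Rightarrow> real"
  assumes plan: "\<And>p s t. (p, s, t) \<in> set L \<Longrightarrow> p \<ge> 0 \<and> s \<in> V \<and> t \<in> V"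
    and mass: "(\<Sum>(p, s, t)\<leftarrow>L. p) = 1"
    and source: "\<And>u. u \<in> V \<Longrightarrow> (\<Sum>(p, s, t)\<leftarrow>L. p * of_bool (u = s)) = \<mu> u"
    and target: "\<And>v. v \<in> V \<Longrightarrow> (\<Sum>(p, s, t)\<leftarrow>L. p * of_bool (v = t)) = \<nu> v"
  shows "(\<Sum>(p, s, t)\<leftarrow>L. p * real (graph_dist E s t)) \<in> transport_costs V E \<mu> \<nu>"
proof -
  define A where "A u v = (\<Sum>(p, s, t)\<leftarrow>L. p * of_bool (u = s) * of_bool (v = t))" for u v
  have "A u v \<ge> 0" for u v
    unfolding A_def by (rule sum_list_nonneg) (use plan in auto)
  moreover have "A u v \<le> (\<Sum>(p, s, t)\<leftarrow>L. p)" for u v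
    unfolding A_def by (rule sum_list_mono) (use plan in auto)
  moreover have "((\<lambda>v. A u v) has_sum \<mu> u) V" if "u \<in> V" for u
    unfolding A_def source[OF that, symmetric] case_prod_unfold
    by (intro has_sum_sum_list has_sum_point_mass) (use plan in auto)
  moreover have "((\<lambda>u. A u v) has_sum \<nu> v) V" if "v \<in> V" for v
  proof -
    have "A u v = (\<Sum>(p, s, t)\<leftarrow>L. p * of_bool (v = t) * of_bool (u = s))" for u
      unfolding A_def by (simp add: mult_ac)
    then show ?thesis
      unfolding target[OF that, symmetric] case_prod_unfold
      by (simp only:, intro has_sum_sum_list has_sum_point_mass) (use plan in auto)
  qed
  ultimately have "A \<in> couplings V \<mu> \<nu>"
    using mass by (auto simp: couplings_def)
  moreover have "((\<lambda>z. \<Sum>x\<leftarrow>L. fst x * real (graph_dist E (fst (snd x)) (snd (snd x)))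
      * of_bool (z = snd x)) has_sum
      (\<Sum>x\<leftarrow>L. fst x * real (graph_dist E (fst (snd x)) (snd (snd x))))) (V \<times> V)"
    by (intro has_sum_sum_list has_sum_point_mass) (use plan in force)
  moreover have "(\<lambda>z. \<Sum>x\<leftarrow>L. fst x * real (graph_dist E (fst (snd x)) (snd (snd x)))
      * of_bool (z = snd x)) = (\<lambda>(u, v). A u v * real (graph_dist E u v))"
  proof (intro ext, clarify)
    fix u v
    show "(\<Sum>x\<leftarrow>L. fst x * real (graph_dist E (fst (snd x)) (snd (snd x)))
      * of_bool ((u, v) = snd x)) = A u v * real (graph_dist E u v)"
      unfolding A_def sum_list_mult_const[symmetric]
      by (intro arg_cong[where f = sum_list] map_cong) auto
  qed
  ultimately show ?thesis
    unfolding transport_costs_def by (auto simp: case_prod_unfold)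
qed

text \<open>Weak Kantorovich duality. The Lipschitz bound on \<open>f\<close> is asked for only from
  the support of the source to that of the target, which leaves finitely many distances to
  check.\<close>

lemma transport_costs_ge:
  fixes f :: "'a \<Rightarrow> real"
  assumes c: "c \<in> transport_costs V E \<mu> \<nu>"
    and S: "finite S" "S \<subseteq> V" "\<And>u. u \<in> V - S \<Longrightarrow> \<mu> u = 0"
    and T: "finite T" "T \<subseteq> V" "\<And>v. v \<in> V - T \<Longrightarrow> \<nu> v = 0"
    and f: "\<And>u v. u \<in> S \<Longrightarrow> v \<in> T \<Longrightarrow> f v - f u \<le> real (graph_dist E u v)"
  shows "(\<Sum>v\<in>T. \<nu> v * f v) - (\<Sum>u\<in>S. \<mu> u * f u) \<le> c"
proof -
  obtain A where A: "A \<in> couplings V \<mu> \<nu>"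
    and cost: "((\<lambda>(u, v). A u v * real (graph_dist E u v)) has_sum c) (V \<times> V)"
    using c by (auto simp: transport_costs_def)
  have nonneg: "A u v \<ge> 0" if "u \<in> V" "v \<in> V" for u v
    using A that by (auto simp: couplings_def)
  have row: "((\<lambda>v. A u v) has_sum \<mu> u) V" if "u \<in> V" for u
    using A that by (auto simp: couplings_def)
  have col: "((\<lambda>u. A u v) has_sum \<nu> v) V" if "v \<in> V" for v
    using A that by (auto simp: couplings_def)
  \<comment> \<open>Nonnegative entries with zero marginal vanish, so \<open>A\<close> lives on the
    finite set \<open>S \<times> T\<close> and all sums become finite.\<close>
  have zero_row: "A u v = 0" if "u \<in> V - S" "v \<in> V" for u v
    by (rule nonneg_has_sum_le_0D[OF row[of u]]) (use S(3)[OF that(1)] nonneg that in auto)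
  have zero_col: "A u v = 0" if "u \<in> V" "v \<in> V - T" for u v
    by (rule nonneg_has_sum_le_0D[OF col[of v]]) (use T(3)[OF that(2)] nonneg that in auto)
  have \<mu>: "\<mu> u = (\<Sum>v\<in>T. A u v)" if "u \<in> S" for u
  proof (rule has_sum_unique[OF row])
    show "((\<lambda>v. A u v) has_sum (\<Sum>v\<in>T. A u v)) V"
      by (rule has_sum_finite_neutralI[of T]) (use T zero_col S that in auto)
  qed (use S that in auto)
  have \<nu>: "\<nu> v = (\<Sum>u\<in>S. A u v)" if "v \<in> T" for v
  proof (rule has_sum_unique[OF col])
    show "((\<lambda>u. A u v) has_sum (\<Sum>u\<in>S. A u v)) V"
      by (rule has_sum_finite_neutralI[of S]) (use S zero_row T that in auto)
  qed (use T that in auto)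
  have "(\<Sum>v\<in>T. \<nu> v * f v) - (\<Sum>u\<in>S. \<mu> u * f u)
      = (\<Sum>v\<in>T. \<Sum>u\<in>S. A u v * f v) - (\<Sum>u\<in>S. \<Sum>v\<in>T. A u v * f u)"
    by (simp add: \<mu> \<nu> sum_distrib_right)
  also have "\<dots> = (\<Sum>u\<in>S. \<Sum>v\<in>T. A u v * (f v - f u))"
    by (subst sum.swap) (simp add: sum_subtractf right_diff_distrib)
  also have "\<dots> \<le> (\<Sum>u\<in>S. \<Sum>v\<in>T. A u v * real (graph_dist E u v))"
    by (intro sum_mono mult_left_mono f nonneg) (use S T in auto)
  also have "\<dots> = c"
  proof (rule has_sum_unique[OF _ cost])
    have "(case z of (u, v) \<Rightarrow> A u v * real (graph_dist E u v)) = 0"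
      if "z \<in> V \<times> V - S \<times> T" for z
      using that zero_row zero_col by (cases z) auto
    then show "((\<lambda>(u, v). A u v * real (graph_dist E u v)) has_sum
        (\<Sum>u\<in>S. \<Sum>v\<in>T. A u v * real (graph_dist E u v))) (V \<times> V)"
      by (intro has_sum_finite_neutralI[of "S \<times> T"])
        (use S(1,2) T(1,2) in \<open>auto simp: sum.cartesian_product\<close>)
  qed
  finally show ?thesis .
qed

text \<open>The product measure is a coupling, and finite supports make its cost finite. This is
  what lets a lower bound on all costs pass to their infimum.\<close>

lemma transport_costs_nonempty:
  fixes \<mu> \<nu> :: "'a \<Rightarrow> real"
  assumes S: "finite S" "S \<subseteq> V" "\<And>u. u \<in> V - S \<Longrightarrow> \<mu> u = 0"
    and T: "finite T" "T \<subseteq> V" "\<And>v. v \<in> V - T \<Longrightarrow> \<nu> v = 0"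
    and \<mu>: "\<And>u. u \<in> V \<Longrightarrow> \<mu> u \<ge> 0" "sum \<mu> S = 1"
    and \<nu>: "\<And>v. v \<in> V \<Longrightarrow> \<nu> v \<ge> 0" "sum \<nu> T = 1"
  shows "transport_costs V E \<mu> \<nu> \<noteq> {}"
proof -
  have sum1: "(\<mu> has_sum 1) V" "(\<nu> has_sum 1) V"
    by (rule has_sum_finite_neutralI; use assms in auto)+
  \<comment> \<open>Entries of a coupling must lie in the unit interval, so both factors of the
    product are bounded by the total mass.\<close>
  have "\<mu> u \<le> 1" if "u \<in> V" for u
    by (rule has_sum_mono2[OF has_sum_finite[of "{u}" \<mu>, simplified] sum1(1)]) (use \<mu> that in auto)
  moreover have "\<nu> u \<le> 1" if "u \<in> V" for u
    by (rule has_sum_mono2[OF has_sum_finite[of "{u}" \<nu>, simplified] sum1(2)]) (use \<nu> that in auto)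
  moreover have "((\<lambda>v. \<mu> u * \<nu> v) has_sum \<mu> u) V" for u
    using has_sum_cmult_right[OF sum1(2), of "\<mu> u"] by simp
  moreover have "((\<lambda>u. \<mu> u * \<nu> v) has_sum \<nu> v) V" for v
    using has_sum_cmult_left[OF sum1(1), of "\<nu> v"] by simp
  ultimately have "(\<lambda>u v. \<mu> u * \<nu> v) \<in> couplings V \<mu> \<nu>"
    using \<mu>(1) \<nu>(1) by (auto simp: couplings_def mult_le_one)
  moreover have "((\<lambda>(u, v). \<mu> u * \<nu> v * real (graph_dist E u v)) has_sum
      (\<Sum>(u, v)\<in>S \<times> T. \<mu> u * \<nu> v * real (graph_dist E u v))) (V \<times> V)"
  proof (rule has_sum_finite_neutralI[of "S \<times> T"])
    show "(case z of (u, v) \<Rightarrow> \<mu> u * \<nu> v * real (graph_dist E u v)) = 0"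
      if "z \<in> V \<times> V - S \<times> T" for z
      using that S(3) T(3) by (cases z) auto
  qed (use S T in auto)
  ultimately show ?thesis by (auto simp: transport_costs_def)
qed

section \<open>Step measures, the curvature as a limit, and criteria for its sign\<close>

context weighted_graph
begin

lemma step_measure_props:
  assumes u: "u \<in> V"
  shows "finite (insert u (E `` {u}))" "insert u (E `` {u}) \<subseteq> V"
    and "\<And>v. v \<in> V - insert u (E `` {u}) \<Longrightarrow> step_measure E w m \<epsilon> u v = 0"
    and "sum (step_measure E w m \<epsilon> u) (insert u (E `` {u})) = 1"
proof -
  have nin: "u \<notin> E `` {u}" using loopless by (auto simp: irrefl_def)
  show "finite (insert u (E `` {u}))" "insert u (E `` {u}) \<subseteq> V"
    using locally_finite[OF u] u edges by auto
  show "\<And>v. v \<in> V - insert u (E `` {u}) \<Longrightarrow> step_measure E w m \<epsilon> u v = 0"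
    by (auto simp: step_measure_def)
  have "sum (step_measure E w m \<epsilon> u) (E `` {u}) = (\<Sum>v\<in>E `` {u}. \<epsilon> * (w u v / m u))"
    using nin by (intro sum.cong) (auto simp: step_measure_def)
  then show "sum (step_measure E w m \<epsilon> u) (insert u (E `` {u})) = 1"
    using locally_finite[OF u] nin
    by (simp add: step_measure_def weighted_degree_def sum_distrib_left)
qed

lemma step_measure_nonneg:
  assumes "u \<in> V" "\<epsilon> \<ge> 0" "\<epsilon> * weighted_degree E w m u \<le> 1"
  shows "step_measure E w m \<epsilon> u v \<ge> 0"
  using assms w_positive[of u v] m_positive[of u] by (auto simp: step_measure_def)

lemma weighted_degree_nonneg: "u \<in> V \<Longrightarrow> weighted_degree E w m u \<ge> 0"
  unfolding weighted_degree_def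
  by (intro sum_nonneg) (use w_positive m_positive in \<open>auto intro!: divide_nonneg_nonneg less_imp_le\<close>)

lemma step_costs_nonempty:
  assumes V: "u \<in> V" "v \<in> V"
  obtains e0 where "e0 > 0" "\<And>\<epsilon>. 0 < \<epsilon> \<Longrightarrow> \<epsilon> \<le> e0 \<Longrightarrow>
    transport_costs V E (step_measure E w m \<epsilon> u) (step_measure E w m \<epsilon> v) \<noteq> {}"
proof
  \<comment> \<open>Small enough to keep the mass at both centres nonnegative; the summand 1 keeps
    the denominator positive.\<close>
  let ?e0 = "1 / (1 + weighted_degree E w m u + weighted_degree E w m v)"
  have deg: "weighted_degree E w m u \<ge> 0" "weighted_degree E w m v \<ge> 0"
    using weighted_degree_nonneg V by auto
  then show "?e0 > 0" by simp
  fix \<epsilon> assume \<epsilon>: "0 < \<epsilon>" "\<epsilon> \<le> ?e0"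
  then have "\<epsilon> * (1 + weighted_degree E w m u + weighted_degree E w m v) \<le> 1"
    using deg by (simp add: pos_le_divide_eq)
  moreover have "\<epsilon> * weighted_degree E w m u \<ge> 0" "\<epsilon> * weighted_degree E w m v \<ge> 0"
    using \<epsilon> deg by auto
  ultimately have le: "\<epsilon> \<ge> 0" "\<epsilon> * weighted_degree E w m u \<le> 1" "\<epsilon> * weighted_degree E w m v \<le> 1"
    using \<epsilon> by (simp_all add: algebra_simps)
  show "transport_costs V E (step_measure E w m \<epsilon> u) (step_measure E w m \<epsilon> v) \<noteq> {}"
    by (rule transport_costs_nonempty[of "insert u (E `` {u})" _ _ "insert v (E `` {v})"])
      (fact step_measure_props[OF V(1)] step_measure_props[OF V(2)]
        | intro step_measure_nonneg V le)+
qed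

lemma step_costs_ge:
  fixes f :: "'a \<Rightarrow> real"
  assumes "c \<in> transport_costs V E (step_measure E w m \<epsilon> u) (step_measure E w m \<epsilon> v)"
    and "u \<in> V" "v \<in> V"
    and f: "\<And>x y. x \<in> insert u (E `` {u}) \<Longrightarrow> y \<in> insert v (E `` {v}) \<Longrightarrow>
        f y - f x \<le> real (graph_dist E x y)"
  shows "(\<Sum>y\<in>insert v (E `` {v}). step_measure E w m \<epsilon> v y * f y)
    - (\<Sum>x\<in>insert u (E `` {u}). step_measure E w m \<epsilon> u x * f x) \<le> c"
  by (rule transport_costs_ge[OF assms(1)])
    (fact step_measure_props[OF assms(2)] step_measure_props[OF assms(3)] | rule f, assumption+)+

text \<open>The step measure at \<open>t * \<epsilon>\<close> mixes the one at
  \<open>\<epsilon>\<close> with the point mass at its centre. Mixing a plan with the point mass at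
  \<open>(u, v)\<close> in the same proportion gives the convexity that makes the curvature quotient
  monotone.\<close>

lemma step_costs_scale:
  assumes c: "c \<in> transport_costs V E (step_measure E w m \<epsilon> u) (step_measure E w m \<epsilon> v)"
    and "u \<in> V" "v \<in> V" "0 \<le> t" "t \<le> 1"
  shows "t * c + (1 - t) * real (graph_dist E u v)
    \<in> transport_costs V E (step_measure E w m (t * \<epsilon>) u) (step_measure E w m (t * \<epsilon>) v)"
proof -
  obtain A where A: "A \<in> couplings V (step_measure E w m \<epsilon> u) (step_measure E w m \<epsilon> v)"
    and cost: "((\<lambda>(u, v). A u v * real (graph_dist E u v)) has_sum c) (V \<times> V)"
    using c by (auto simp: transport_costs_def)
  define B where "B x y = t * A x y + (1 - t) * of_bool ((x, y) = (u, v))" for x y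
  have sm: "step_measure E w m (t * \<epsilon>) z x = t * step_measure E w m \<epsilon> z x + (1 - t) * of_bool (x = z)"
    for z x by (auto simp: step_measure_def algebra_simps)
  have "B \<in> couplings V (step_measure E w m (t * \<epsilon>) u) (step_measure E w m (t * \<epsilon>) v)"
    unfolding couplings_def mem_Collect_eq
  proof (intro conjI ballI)
    fix x assume x: "x \<in> V"
    have "((\<lambda>y. t * A x y) has_sum t * step_measure E w m \<epsilon> u x) V"
      by (rule has_sum_cmult_right) (use A x in \<open>auto simp: couplings_def\<close>)
    moreover have "((\<lambda>y. (1 - t) * of_bool (x = u) * of_bool (y = v)) has_sum (1 - t) * of_bool (x = u)) V"
      by (rule has_sum_point_mass) fact
    ultimately have "((\<lambda>y. t * A x y + (1 - t) * of_bool (x = u) * of_bool (y = v)) has_sum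
        t * step_measure E w m \<epsilon> u x + (1 - t) * of_bool (x = u)) V"
      by (rule has_sum_add)
    then show "((\<lambda>y. B x y) has_sum step_measure E w m (t * \<epsilon>) u x) V"
      unfolding B_def sm by (simp add: of_bool_conj mult.assoc)
  next
    fix y assume y: "y \<in> V"
    have "((\<lambda>x. t * A x y) has_sum t * step_measure E w m \<epsilon> v y) V"
      by (rule has_sum_cmult_right) (use A y in \<open>auto simp: couplings_def\<close>)
    moreover have "((\<lambda>x. (1 - t) * of_bool (y = v) * of_bool (x = u)) has_sum (1 - t) * of_bool (y = v)) V"
      by (rule has_sum_point_mass) fact
    ultimately have "((\<lambda>x. t * A x y + (1 - t) * of_bool (y = v) * of_bool (x = u)) has_sum
        t * step_measure E w m \<epsilon> v y + (1 - t) * of_bool (y = v)) V"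
      by (rule has_sum_add)
    then show "((\<lambda>x. B x y) has_sum step_measure E w m (t * \<epsilon>) v y) V"
      unfolding B_def sm by (simp add: of_bool_conj mult_ac)
  next
    fix x y assume "x \<in> V" "y \<in> V"
    then have "A x y \<in> {0..1}" using A by (auto simp: couplings_def)
    then have "t * A x y \<ge> 0" "t * A x y \<le> t"
      using \<open>0 \<le> t\<close> by (auto simp: mult_left_le)
    then show "B x y \<in> {0..1}"
      using \<open>t \<le> 1\<close> \<open>0 \<le> t\<close> by (auto simp: B_def of_bool_def)
  qed
  moreover have "((\<lambda>(x, y). B x y * real (graph_dist E x y)) has_sum
      t * c + (1 - t) * real (graph_dist E u v)) (V \<times> V)"
  proof -
    have "((\<lambda>z. (1 - t) * real (graph_dist E u v) * of_bool (z = (u, v)))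
        has_sum (1 - t) * real (graph_dist E u v)) (V \<times> V)"
      by (rule has_sum_point_mass) (use assms in auto)
    from has_sum_add[OF has_sum_cmult_right[OF cost, of t] this] show ?thesis
      by (rule has_sum_cong[THEN iffD1, rotated]) (auto simp: B_def algebra_simps)
  qed
  ultimately show ?thesis by (auto simp: transport_costs_def)
qed

text \<open>By convexity, \<open>\<kappa>\<^sub>\<epsilon> / \<epsilon>\<close> does not decrease as \<open>\<epsilon>\<close> tends to \<open>0\<close>, and the test function vanishing
  at \<open>u\<close> only and equal to \<open>1\<close> elsewhere bounds it from above.\<close>

lemma curvature_tendsto:
  assumes uv: "(u, v) \<in> E"
  shows "((\<lambda>\<epsilon>. 1 / \<epsilon> * eps_curvature V E w m \<epsilon> u v) \<longlongrightarrow> curvature V E w m u v) (at_right 0)"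
proof -
  define W where "W \<epsilon> = wasserstein V E (step_measure E w m \<epsilon> u) (step_measure E w m \<epsilon> v)" for \<epsilon>
  define C where "C \<epsilon> = transport_costs V E (step_measure E w m \<epsilon> u) (step_measure E w m \<epsilon> v)" for \<epsilon>
  define g where "g \<epsilon> = 1 / \<epsilon> * eps_curvature V E w m \<epsilon> u v" for \<epsilon>
  have V: "u \<in> V" "v \<in> V" using uv edges by auto
  obtain e0 where e0: "e0 > 0" and nonempty: "\<And>\<epsilon>. 0 < \<epsilon> \<Longrightarrow> \<epsilon> \<le> e0 \<Longrightarrow> C \<epsilon> \<noteq> {}"
    using step_costs_nonempty[OF V] unfolding C_def by blast
  have dist: "graph_dist E u v = 1" using graph_dist_adjacent[OF uv] .
  have g: "g \<epsilon> = (1 - W \<epsilon>) / \<epsilon>" for \<epsilon>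
    by (simp add: g_def eps_curvature_def dist W_def)
  \<comment> \<open>With \<open>t = r / s\<close>, scaling gives
    \<open>W r \<le> t * W s + (1 - t)\<close>, that is \<open>t * (1 - W s) \<le> 1 - W r\<close>;
    dividing by \<open>r\<close> yields the claim.\<close>
  have mono: "g s \<le> g r" if r: "0 < r" "r \<le> s" "s \<le> e0" for r s
  proof -
    define t where "t = r / s"
    have t: "0 < t" "t \<le> 1" "t * s = r" using r by (auto simp: t_def)
    have "(W r - (1 - t)) / t \<le> c" if "c \<in> C s" for c
    proof -
      have "t * c + (1 - t) * real (graph_dist E u v) \<in> C r"
        using step_costs_scale[of c s u v t] that V t by (simp add: C_def)
      then have "W r \<le> t * c + (1 - t)"
        unfolding W_def C_def dist by (auto dest: wasserstein_le)
      then show ?thesis using t by (simp add: pos_divide_le_eq mult.commute)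
    qed
    then have "(W r - (1 - t)) / t \<le> W s"
      unfolding W_def wasserstein_eq_Inf C_def[symmetric]
      using nonempty[of s] r by (intro cInf_greatest) auto
    then have "t * (1 - W s) \<le> 1 - W r" using t by (simp add: pos_divide_le_eq algebra_simps)
    then show ?thesis using r unfolding g t_def by (simp add: field_simps)
  qed
  \<comment> \<open>For the test function the dual value is the mass at \<open>u\<close> of the
    measure of \<open>u\<close> minus that of the measure of \<open>v\<close>, which equals
    \<open>1 - \<epsilon> * B\<close>.\<close>
  define B where "B = w v u / m v + weighted_degree E w m u"
  have bound: "g \<epsilon> \<le> B" if \<epsilon>: "0 < \<epsilon>" "\<epsilon> \<le> e0" for \<epsilon>
  proof -
    define f :: "'a \<Rightarrow> real" where "f x = 1 - of_bool (x = u)" for x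
    have "1 - \<epsilon> * B \<le> c" if "c \<in> C \<epsilon>" for c
    proof -
      have "f y - f x \<le> real (graph_dist E x y)"
        if "x \<in> insert u (E `` {u})" "y \<in> insert v (E `` {v})" for x y
        using that graph_dist_pos[of x y] edges V by (auto simp: f_def)
      from step_costs_ge[OF \<open>c \<in> C \<epsilon>\<close>[unfolded C_def] V this]
      have *: "(\<Sum>y\<in>insert v (E `` {v}). step_measure E w m \<epsilon> v y * f y)
        - (\<Sum>x\<in>insert u (E `` {u}). step_measure E w m \<epsilon> u x * f x) \<le> c" .
      have sums: "(\<Sum>y\<in>insert z (E `` {z}). step_measure E w m \<epsilon> z y * f y)
        = 1 - step_measure E w m \<epsilon> z u" if "z \<in> V" "u \<in> insert z (E `` {z})" for z
      proof -
        have "(\<Sum>y\<in>insert z (E `` {z}). step_measure E w m \<epsilon> z y * f y)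
          = sum (step_measure E w m \<epsilon> z) (insert z (E `` {z}))
            - (\<Sum>y\<in>insert z (E `` {z}). if y = u then step_measure E w m \<epsilon> z u else 0)"
          unfolding sum_subtractf[symmetric] by (rule sum.cong) (auto simp: f_def)
        then show ?thesis
          using step_measure_props(1,4)[OF that(1)] that(2) by (simp add: sum.delta)
      qed
      have "(v, u) \<in> E" "u \<noteq> v" using uv symD[OF symmetric] loopless by (auto simp: irrefl_def)
      with * sums[of u] sums[of v] V show ?thesis
        by (simp add: step_measure_def B_def algebra_simps)
    qed
    then have "1 - \<epsilon> * B \<le> W \<epsilon>"
      unfolding W_def wasserstein_eq_Inf C_def[symmetric]
      using nonempty[OF \<epsilon>] by (intro cInf_greatest) auto
    then show ?thesis using \<epsilon> unfolding g by (simp add: pos_divide_le_eq mult.commute)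
  qed
  \<comment> \<open>A bounded quotient that grows as \<open>\<epsilon>\<close> decreases converges
    to its supremum.\<close>
  define L where "L = Sup (g ` {0<..e0})"
  have bdd: "bdd_above (g ` {0<..e0})" using bound by (intro bdd_aboveI2[of _ _ B]) auto
  have "(g \<longlongrightarrow> L) (at_right 0)"
  proof (rule order_tendstoI)
    fix a assume "a < L"
    then obtain s where s: "0 < s" "s \<le> e0" "a < g s"
      using e0 bdd unfolding L_def by (subst (asm) less_cSup_iff) auto
    have "a < g r" if "0 < r" "r < s" for r
      using mono[of r s] s that by auto
    then show "eventually (\<lambda>x. a < g x) (at_right 0)"
      unfolding eventually_at_right_field using s by blast
  next
    fix a assume "L < a"
    have "g r < a" if "0 < r" "r < e0" for r
      using cSup_upper[OF _ bdd, of "g r"] that \<open>L < a\<close> unfolding L_def by fastforce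
    then show "eventually (\<lambda>x. g x < a) (at_right 0)"
      unfolding eventually_at_right_field using e0 by blast
  qed
  \<comment> \<open>\<open>curvature\<close> is a \<open>Lim\<close>, which equals the limit just
    found because \<open>at_right 0\<close> is a nontrivial filter.\<close>
  then show ?thesis
    using tendsto_Lim[OF trivial_limit_at_right_real] unfolding curvature_def g_def by blast
qed

text \<open>In \<open>L \<epsilon>\<close>, an entry \<open>(p, x, y, k)\<close> moves mass \<open>p\<close> from \<open>x\<close> to \<open>y\<close> at distance at most \<open>k\<close>.\<close>

lemma curvature_nonneg:
  fixes e0 :: real and L :: "real \<Rightarrow> (real \<times> 'a \<times> 'a \<times> nat) list"
  assumes uv: "(u, v) \<in> E" and e0: "e0 > 0"
    and plan: "\<And>\<epsilon> p x y k. 0 < \<epsilon> \<Longrightarrow> \<epsilon> < e0 \<Longrightarrow> (p, x, y, k) \<in> set (L \<epsilon>) \<Longrightarrow>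
        p \<ge> 0 \<and> x \<in> V \<and> y \<in> V \<and> graph_dist E x y \<le> k"
    and mass: "\<And>\<epsilon>. (\<Sum>(p, x, y, k)\<leftarrow>L \<epsilon>. p) = 1"
    and source: "\<And>\<epsilon> z. (\<Sum>(p, x, y, k)\<leftarrow>L \<epsilon>. p * of_bool (z = x)) = step_measure E w m \<epsilon> u z"
    and target: "\<And>\<epsilon> z. (\<Sum>(p, x, y, k)\<leftarrow>L \<epsilon>. p * of_bool (z = y)) = step_measure E w m \<epsilon> v z"
    and cost: "\<And>\<epsilon>. 0 < \<epsilon> \<Longrightarrow> (\<Sum>(p, x, y, k)\<leftarrow>L \<epsilon>. p * real k) \<le> 1"
  shows "curvature V E w m u v \<ge> 0"
proof (rule tendsto_lowerbound[OF curvature_tendsto[OF uv]])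
  have "0 \<le> 1 / \<epsilon> * eps_curvature V E w m \<epsilon> u v" if \<epsilon>: "0 < \<epsilon>" "\<epsilon> < e0" for \<epsilon>
  proof -
    \<comment> \<open>Dropping the bounds \<open>k\<close> leaves a genuine plan, whose cost for the
      true distances is at most the one computed from the bounds.\<close>
    define L' where "L' = map (\<lambda>(p, x, y, k). (p, x, y)) (L \<epsilon>)"
    have "(\<Sum>(p, x, y)\<leftarrow>L'. p * real (graph_dist E x y))
      \<in> transport_costs V E (step_measure E w m \<epsilon> u) (step_measure E w m \<epsilon> v)"
    proof (rule transport_costs_plan)
      show "p \<ge> 0 \<and> x \<in> V \<and> y \<in> V" if "(p, x, y) \<in> set L'" for p x y
        using that plan[OF \<epsilon>] by (fastforce simp: L'_def)
    qed (use mass[of \<epsilon>] source[where \<epsilon> = \<epsilon>] target[where \<epsilon> = \<epsilon>] in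
          \<open>simp_all add: L'_def comp_def case_prod_unfold\<close>)
    moreover have "(\<Sum>(p, x, y)\<leftarrow>L'. p * real (graph_dist E x y)) \<le> (\<Sum>(p, x, y, k)\<leftarrow>L \<epsilon>. p * real k)"
      unfolding L'_def map_map
      by (intro sum_list_mono) (use plan[OF \<epsilon>] in \<open>auto intro!: mult_left_mono\<close>)
    ultimately have "wasserstein V E (step_measure E w m \<epsilon> u) (step_measure E w m \<epsilon> v) \<le> 1"
      using cost[OF \<epsilon>(1)] wasserstein_le by fastforce
    then show ?thesis
      using \<epsilon> graph_dist_adjacent[OF uv] by (simp add: eps_curvature_def)
  qed
  then show "\<forall>\<^sub>F \<epsilon> in at_right 0. 0 \<le> 1 / \<epsilon> * eps_curvature V E w m \<epsilon> u v"
    unfolding eventually_at_right_field using e0 by blast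
qed simp

text \<open>The excess \<open>b\<close> per unit of \<open>\<epsilon>\<close> is uniform, so the
  curvature is at most \<open>- b\<close> and strictness survives the limit.\<close>

lemma curvature_negative:
  assumes uv: "(u, v) \<in> E" and b: "b > 0"
    and cost: "\<And>\<epsilon> c. \<epsilon> > 0 \<Longrightarrow>
      c \<in> transport_costs V E (step_measure E w m \<epsilon> u) (step_measure E w m \<epsilon> v) \<Longrightarrow> 1 + b * \<epsilon> \<le> c"
  shows "curvature V E w m u v < 0"
proof -
  have V: "u \<in> V" "v \<in> V" using uv edges by auto
  obtain e0 where "e0 > 0" and nonempty: "\<And>\<epsilon>. 0 < \<epsilon> \<Longrightarrow> \<epsilon> \<le> e0 \<Longrightarrow>
      transport_costs V E (step_measure E w m \<epsilon> u) (step_measure E w m \<epsilon> v) \<noteq> {}"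
    using step_costs_nonempty[OF V] by blast
  have "curvature V E w m u v \<le> - b"
  proof (rule tendsto_upperbound[OF curvature_tendsto[OF uv]])
    have "1 / \<epsilon> * eps_curvature V E w m \<epsilon> u v \<le> - b" if "\<epsilon> > 0" "\<epsilon> < e0" for \<epsilon>
    proof -
      have "1 + b * \<epsilon> \<le> wasserstein V E (step_measure E w m \<epsilon> u) (step_measure E w m \<epsilon> v)"
        unfolding wasserstein_eq_Inf using cost[OF that(1)] nonempty[of \<epsilon>] that by (intro cInf_greatest) auto
      then show ?thesis
        using that graph_dist_adjacent[OF uv] by (simp add: eps_curvature_def divide_simps)
    qed
    with \<open>e0 > 0\<close> show "\<forall>\<^sub>F \<epsilon> in at_right 0. 1 / \<epsilon> * eps_curvature V E w m \<epsilon> u v \<le> - b"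
      unfolding eventually_at_right_field by blast
  qed simp
  with b show ?thesis by simp
qed

text \<open>A step measure sees the vertex weight only at its centre, and multiplying it there by
  \<open>k\<close> replaces \<open>\<epsilon>\<close> by \<open>\<epsilon> / k\<close>. The rest is
  a change of variable in the limit.\<close>

lemma curvature_scale:
  assumes uv: "(u, v) \<in> E" and k: "k > 0"
    and m': "m' u = k * m u" "m' v = k * m v"
  shows "curvature V E w m' u v = curvature V E w m u v / k"
proof -
  have "step_measure E w m' \<epsilon> z = step_measure E w m (\<epsilon> / k) z" if "m' z = k * m z" for z \<epsilon>
    using k that by (auto simp: step_measure_def weighted_degree_def sum_distrib_left intro!: sum.cong ext)
  then have eps: "eps_curvature V E w m' \<epsilon> u v = eps_curvature V E w m (\<epsilon> / k) u v" for \<epsilon>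
    using m' by (simp add: eps_curvature_def)
  have "filterlim (\<lambda>\<epsilon>. \<epsilon> / k) (at_right 0) (at_right 0)"
    unfolding filterlim_at using k
    by (auto intro!: tendsto_eq_intros eventually_at_right_less[THEN eventually_mono])
  from tendsto_divide[OF filterlim_compose[OF curvature_tendsto[OF uv] this] tendsto_const[of k]] k
  have "((\<lambda>\<epsilon>. 1 / \<epsilon> * eps_curvature V E w m' \<epsilon> u v) \<longlongrightarrow> curvature V E w m u v / k) (at_right 0)"
    by (simp add: eps)
  then show ?thesis
    using tendsto_Lim[OF trivial_limit_at_right_real] unfolding curvature_def by blast
qed

end

section \<open>Edges classified by the degrees of their endpoints\<close>

context simple_graph
begin

abbreviation "combinatorial_curvature \<equiv>
  curvature V E unit_edge_weight combinatorial_vertex_weight"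

abbreviation "normalized_curvature \<equiv>
  curvature V E unit_edge_weight (normalized_vertex_weight E)"

lemmas unit_step_simps = step_measure_def weighted_degree_def unit_edge_weight_def
  combinatorial_vertex_weight_def normalized_vertex_weight_def vertex_degree_def

text \<open>The measure of the leaf \<open>x\<close> already has mass on \<open>y\<close>, one step
  from the other neighbours of \<open>y\<close>, and the mass that the measure of \<open>y\<close>
  puts on \<open>x\<close> can stay in place. These savings offset any longer move.\<close>

lemma leaf_edge_nonneg:
  assumes x: "E `` {x} = {y}" and y: "card (E `` {y}) \<in> {2, 3}"
  shows "combinatorial_curvature x y \<ge> 0 \<and> normalized_curvature x y \<ge> 0"
proof -
  have xy: "(x, y) \<in> E" using x by auto
  then have yx: "(y, x) \<in> E" using symD[OF symmetric] by auto
  have dist_le: "(s, t) \<in> E \<Longrightarrow> (t, z) \<in> E \<Longrightarrow> graph_dist E s z \<le> 2" for s t z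
    by (rule graph_dist_le) (auto simp: numeral_2_eq_2)
  interpret C: weighted_graph V E unit_edge_weight combinatorial_vertex_weight
    by (rule combinatorial_weighted_graph)
  interpret N: weighted_graph V E unit_edge_weight "normalized_vertex_weight E"
    by (rule normalized_weighted_graph) (use xy in auto)
  have V: "x \<in> V" "y \<in> V" using xy edges by auto
  from y consider b where "E `` {y} = {x, b}" "b \<noteq> x"
    | b c where "E `` {y} = {x, b, c}" "b \<noteq> x" "c \<noteq> x" "b \<noteq> c"
  proof -
    have fin: "finite (E `` {y})" using y card_ge_0_finite by force
    have ins: "E `` {y} = insert x (E `` {y} - {x})" using yx by auto
    from y consider "card (E `` {y} - {x}) = 1" | "card (E `` {y} - {x}) = 2"
      using fin yx by auto
    then show thesis
    proof cases
      case 1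
      then obtain b where "E `` {y} - {x} = {b}" by (rule card_1_singletonE)
      with ins that(1)[of b] show thesis by auto
    next
      case 2
      then obtain b c where "E `` {y} - {x} = {b, c}" "b \<noteq> c" by (auto simp: card_2_iff)
      with ins that(2)[of b c] show thesis by auto
    qed
  qed
  then show ?thesis
  proof cases
    case 1
    have yb: "(y, b) \<in> E" using 1 by auto
    have ne: "x \<noteq> y" "y \<noteq> b" using xy yb loopless by (auto simp: irrefl_def)
    have bV: "b \<in> V" using yb edges by auto
    note d = graph_dist_adjacent[OF xy] graph_dist_adjacent[OF yb]
    have nb: "(x, z) \<in> E \<longleftrightarrow> z = y" "(y, z) \<in> E \<longleftrightarrow> z = x \<or> z = b" for z
      using x 1(1) by blast+
    \<comment> \<open>The cost is \<open>1 - \<epsilon>\<close>. The bound 1/4, also in the plans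
      below, keeps the bulk moved from \<open>x\<close> to \<open>y\<close> nonnegative.\<close>
    have "combinatorial_curvature x y \<ge> 0"
      by (rule C.curvature_nonneg[OF xy, of "1/4"
            "\<lambda>\<epsilon>. [(\<epsilon>, x, x, 0), (\<epsilon>, y, b, 1), (1 - 2 * \<epsilon>, x, y, 1)]"])
        (use ne 1 V bV d in \<open>auto simp: unit_step_simps x nb\<close>)
    moreover have "normalized_curvature x y \<ge> 0"
      by (rule N.curvature_nonneg[OF xy, of "1/4"
            "\<lambda>\<epsilon>. [(\<epsilon>/2, x, x, 0), (\<epsilon>/2, y, b, 1), (\<epsilon>/2, y, y, 0), (1 - 3/2 * \<epsilon>, x, y, 1)]"])
        (use ne 1 V bV d in \<open>auto simp: unit_step_simps x nb\<close>)
    ultimately show ?thesis ..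
  next
    case 2
    have yb: "(y, b) \<in> E" "(y, c) \<in> E" using 2 by auto
    have ne: "x \<noteq> y" "y \<noteq> b" "y \<noteq> c" using xy yb loopless by (auto simp: irrefl_def)
    have bV: "b \<in> V" "c \<in> V" using yb edges by auto
    note d = graph_dist_adjacent[OF xy] graph_dist_adjacent[OF yb(1)] graph_dist_adjacent[OF yb(2)]
      dist_le[OF xy yb(2)]
    have nb: "(x, z) \<in> E \<longleftrightarrow> z = y" "(y, z) \<in> E \<longleftrightarrow> z = x \<or> z = b \<or> z = c" for z
      using x 2(1) by blast+
    \<comment> \<open>The mass \<open>\<epsilon>\<close> on \<open>y\<close> serves only
      \<open>b\<close>, so \<open>c\<close> is fed from \<open>x\<close> at distance 2; the cost is
      exactly 1.\<close>
    have "combinatorial_curvature x y \<ge> 0"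
      by (rule C.curvature_nonneg[OF xy, of "1/4"
            "\<lambda>\<epsilon>. [(\<epsilon>, x, x, 0), (\<epsilon>, y, b, 1), (\<epsilon>, x, c, 2), (1 - 3 * \<epsilon>, x, y, 1)]"])
        (use ne 2 V bV d in \<open>auto simp: unit_step_simps x nb\<close>)
    moreover have "normalized_curvature x y \<ge> 0"
      by (rule N.curvature_nonneg[OF xy, of "1/4"
            "\<lambda>\<epsilon>. [(\<epsilon>/3, x, x, 0), (\<epsilon>/3, y, b, 1), (\<epsilon>/3, y, c, 1), (\<epsilon>/3, y, y, 0),
              (1 - 4/3 * \<epsilon>, x, y, 1)]"])
        (use ne 2 V bV d in \<open>auto simp: unit_step_simps x nb\<close>)
    ultimately show ?thesis ..
  qed
qed

lemma two_three_edge: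
  assumes x: "E `` {x} = {y, a}" "a \<noteq> y"
    and y: "E `` {y} = {x, b, c}" "b \<noteq> x" "c \<noteq> x" "b \<noteq> c"
  shows two_three_edge_nonneg: "graph_dist E a b \<le> 2 \<Longrightarrow>
      combinatorial_curvature x y \<ge> 0 \<and> normalized_curvature x y \<ge> 0"
    and two_three_edge_negative: "3 \<le> graph_dist E a b \<Longrightarrow> 3 \<le> graph_dist E a c \<Longrightarrow>
      combinatorial_curvature x y < 0 \<and> normalized_curvature x y < 0"
proof -
  have xy: "(x, y) \<in> E" and xa: "(x, a) \<in> E" and yb: "(y, b) \<in> E" and yc: "(y, c) \<in> E"
    using x y by auto
  have ax: "(a, x) \<in> E" using xa symD[OF symmetric] by auto
  interpret C: weighted_graph V E unit_edge_weight combinatorial_vertex_weight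
    by (rule combinatorial_weighted_graph)
  interpret N: weighted_graph V E unit_edge_weight "normalized_vertex_weight E"
    by (rule normalized_weighted_graph) (use xy in auto)
  have V: "x \<in> V" "y \<in> V" "a \<in> V" "b \<in> V" "c \<in> V" using xy xa yb yc edges by auto
  have ne: "x \<noteq> y" "y \<noteq> b" "y \<noteq> c" "x \<noteq> a" using xy xa yb yc loopless by (auto simp: irrefl_def)
  note d = graph_dist_adjacent[OF xy] graph_dist_adjacent[OF ax] graph_dist_adjacent[OF yb]
    graph_dist_adjacent[OF yc]
  have nb: "(x, z) \<in> E \<longleftrightarrow> z = y \<or> z = a" "(y, z) \<in> E \<longleftrightarrow> z = x \<or> z = b \<or> z = c" for z
    using x(1) y(1) by blast+
  \<comment> \<open>Along the walk \<open>a, x, y, c\<close>; the normalized plan has to use this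
    longer route.\<close>
  have ac: "graph_dist E a c \<le> 3"
    using graph_dist_triangle[of a x c] graph_dist_triangle[of x y c] V d by simp
  {
    assume ab: "graph_dist E a b \<le> 2"
    \<comment> \<open>The short route from \<open>a\<close> to \<open>b\<close> brings the cost to
      exactly 1: \<open>2 * \<epsilon> + \<epsilon> + (1 - 3 * \<epsilon>)\<close>.\<close>
    have "combinatorial_curvature x y \<ge> 0"
      by (rule C.curvature_nonneg[OF xy, of "1/4"
            "\<lambda>\<epsilon>. [(\<epsilon>, a, b, 2), (\<epsilon>, y, c, 1), (\<epsilon>, x, x, 0), (1 - 3 * \<epsilon>, x, y, 1)]"])
        (use ne x y V d ab in \<open>auto simp: unit_step_simps nb\<close>)
    \<comment> \<open>Here \<open>a\<close> holds \<open>\<epsilon>/2\<close> but \<open>b\<close>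
      takes only \<open>\<epsilon>/3\<close>, so \<open>\<epsilon>/6\<close> goes on to
      \<open>c\<close>. The moves other than the bulk cost
      \<open>(2/3 + 1/2 + 1/6) * \<epsilon> = 4/3 * \<epsilon>\<close>, again 1 in total.\<close>
    moreover have "normalized_curvature x y \<ge> 0"
      by (rule N.curvature_nonneg[OF xy, of "1/4"
            "\<lambda>\<epsilon>. [(\<epsilon>/3, a, b, 2), (\<epsilon>/6, a, c, 3), (\<epsilon>/3, x, x, 0), (\<epsilon>/6, y, c, 1), (\<epsilon>/3, y, y, 0),
              (1 - 4/3 * \<epsilon>, x, y, 1)]"])
        (use ne x y V d ab ac in \<open>auto simp: unit_step_simps nb\<close>)
    ultimately show "combinatorial_curvature x y \<ge> 0 \<and> normalized_curvature x y \<ge> 0" ..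
  }
  {
    assume far: "3 \<le> graph_dist E a b" "3 \<le> graph_dist E a c"
    define f :: "'a \<Rightarrow> real"
      where "f z = (if z = a then -1 else if z = x then 0 else if z = y then 1 else 2)" for z
    have ne': "a \<noteq> b" "a \<noteq> c" using far by auto
    \<comment> \<open>Shortening a pair at distance at least 3 by one edge costs at most 1; these
      are the pairs on which \<open>f\<close> rises by 2.\<close>
    have far': "2 \<le> graph_dist E x b" "2 \<le> graph_dist E x c" "2 \<le> graph_dist E a y"
      using graph_dist_triangle[of a x b] graph_dist_triangle[of a x c]
        graph_dist_triangle[of a y b] V d far by auto
    have f: "f t - f s \<le> real (graph_dist E s t)"
      if "s \<in> insert x (E `` {x})" "t \<in> insert y (E `` {y})" for s t
      using that far far' ne ne' x y d unfolding x(1) y(1) by (auto simp: f_def)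
    \<comment> \<open>The values at \<open>y\<close> and \<open>a\<close> cancel, so
      \<open>f\<close> has mean 0 for the measure of \<open>x\<close>; for that of \<open>y\<close>
      it has mean \<open>(1 - 3 * \<epsilon>) + 4 * \<epsilon>\<close>.\<close>
    have "combinatorial_curvature x y < 0"
    proof (rule C.curvature_negative[OF xy, of 1])
      fix \<epsilon> z :: real
      assume "z \<in> transport_costs V E
        (step_measure E unit_edge_weight combinatorial_vertex_weight \<epsilon> x)
        (step_measure E unit_edge_weight combinatorial_vertex_weight \<epsilon> y)"
      from C.step_costs_ge[OF this V(1,2) f] show "1 + 1 * \<epsilon> \<le> z"
        using ne ne' x y by (simp add: unit_step_simps f_def nb)
    qed simp
    \<comment> \<open>The mean for \<open>x\<close> is again 0, and for \<open>y\<close> it is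
      \<open>(1 - \<epsilon>) + 4/3 * \<epsilon>\<close>.\<close>
    moreover have "normalized_curvature x y < 0"
    proof (rule N.curvature_negative[OF xy, of "1/3"])
      fix \<epsilon> z :: real
      assume "z \<in> transport_costs V E
        (step_measure E unit_edge_weight (normalized_vertex_weight E) \<epsilon> x)
        (step_measure E unit_edge_weight (normalized_vertex_weight E) \<epsilon> y)"
      from N.step_costs_ge[OF this V(1,2) f] show "1 + 1/3 * \<epsilon> \<le> z"
        using ne ne' x y by (simp add: unit_step_simps f_def nb)
    qed simp
    ultimately show "combinatorial_curvature x y < 0 \<and> normalized_curvature x y < 0" ..
  }
qed

lemma edge_curvature_nonneg_iff:
  assumes uv: "(u, v) \<in> E" and deg: "vertex_degree E u \<le> 3" "vertex_degree E v \<le> 3"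
  shows "combinatorial_curvature u v \<ge> 0 \<longleftrightarrow> normalized_curvature u v \<ge> 0"
proof -
  have less: "combinatorial_curvature x y \<ge> 0 \<longleftrightarrow> normalized_curvature x y \<ge> 0"
    if xy: "(x, y) \<in> E" and lt: "vertex_degree E x < vertex_degree E y"
      and le: "vertex_degree E y \<le> 3" for x y
  proof -
    have yx: "(y, x) \<in> E" using xy symD[OF symmetric] by auto
    have fin: "finite (E `` {x})" "finite (E `` {y})" using xy edges locally_finite by auto
    have pos: "card (E `` {x}) > 0" using fin xy by (auto simp: card_gt_0_iff)
    show ?thesis
    proof (cases "card (E `` {x}) = 1")
      case True
      then have "E `` {x} = {y}" using xy by (metis card_1_singletonE ImageI singletonD singletonI)
      moreover have "card (E `` {y}) \<in> {2, 3}" using True lt le by (auto simp: vertex_degree_def)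
      ultimately show ?thesis using leaf_edge_nonneg by simp
    next
      case False
      \<comment> \<open>Positive degrees, strictly increasing, at most 3 and not starting at 1 can
        only be 2 and 3.\<close>
      then have "card (E `` {x} - {y}) = 1" "card (E `` {y} - {x}) = 2"
        using xy yx fin pos lt le by (auto simp: vertex_degree_def)
      then obtain a b c where abc: "E `` {x} - {y} = {a}" "E `` {y} - {x} = {b, c}" "b \<noteq> c"
        by (auto simp: card_1_singleton_iff card_2_iff)
      then have nb: "E `` {x} = {y, a}" "a \<noteq> y" "E `` {y} = {x, b, c}" "b \<noteq> x" "c \<noteq> x" "b \<noteq> c"
        using xy yx by auto
      \<comment> \<open>The nonnegative case singles out \<open>b\<close>; exchanging
        \<open>b\<close> and \<open>c\<close> covers the case where \<open>c\<close> is the one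
        close to \<open>a\<close>.\<close>
      then have nb': "E `` {y} = {x, c, b}" by auto
      consider "graph_dist E a b \<le> 2" | "graph_dist E a c \<le> 2"
        | "3 \<le> graph_dist E a b" "3 \<le> graph_dist E a c" by linarith
      then show ?thesis
      proof cases
        case 1
        then show ?thesis using two_three_edge_nonneg[OF nb] by simp
      next
        case 2
        then show ?thesis
          using two_three_edge_nonneg[OF nb(1,2) nb' nb(5,4) nb(6)[symmetric]] by simp
      next
        case 3
        then show ?thesis using two_three_edge_negative[OF nb] by simp
      qed
    qed
  qed
  consider "vertex_degree E u < vertex_degree E v" | "vertex_degree E v < vertex_degree E u"
    | "vertex_degree E u = vertex_degree E v" by linarith
  then show ?thesis
  proof cases
    case 1
    then show ?thesis using less uv deg by blast
  next
    case 2
    then show ?thesis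
      using less[of v u] symD[OF symmetric uv] deg by (simp add: curvature_commute[of _ _ v u])
  next
    case 3
    interpret C: weighted_graph V E unit_edge_weight combinatorial_vertex_weight
      by (rule combinatorial_weighted_graph)
    have "vertex_degree E u > 0"
      using uv edges locally_finite by (auto simp: vertex_degree_def card_gt_0_iff)
    with 3 have "normalized_curvature u v = combinatorial_curvature u v / vertex_degree E u"
      by (intro C.curvature_scale[OF uv])
        (auto simp: normalized_vertex_weight_def combinatorial_vertex_weight_def)
    with \<open>vertex_degree E u > 0\<close> show ?thesis by (simp add: zero_le_divide_iff)
  qed
qed

end

theorem theorem2p5:
  fixes V :: "'a set" and E :: "('a \<times> 'a) set"
  assumes "simple_graph V E"
    and "\<forall>u\<in>V. vertex_degree E u \<le> 3"
  shows "graph_curvature V E unit_edge_weight combinatorial_vertex_weight \<ge> 0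
     \<longleftrightarrow> graph_curvature V E unit_edge_weight (normalized_vertex_weight E) \<ge> 0"
proof -
  interpret simple_graph V E by fact
  have "combinatorial_curvature u v \<ge> 0 \<longleftrightarrow> normalized_curvature u v \<ge> 0" if "(u, v) \<in> E" for u v
    using edge_curvature_nonneg_iff[OF that] that edges assms(2) by blast
  \<comment> \<open>A nonnegative infimum means nonnegativity on every edge; without edges both
    infima are infinite.\<close>
  then show ?thesis
    by (auto simp: graph_curvature_def le_INF_iff zero_ereal_def)
qed

end
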